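(* Let $B$ be a locale and let $X$ be a $B$-locale with projection $p:X\to B$. Then $X$ is open if and only if there is a monotone equivariant map $\varsigma:X\to B$ such that the following (necessarily equivalent, for a monotone equivariant map $\varsigma$) conditions are satisfied for all $x\in X$: (a) $\varsigma(x)1\ge x$; (b) $\varsigma(x)x\ge x$; (c) $\varsigma(x)x=x$. Furthermore, there is at most one such map $\varsigma$. If one exists it is necessarily a $B$-module homomorphism and it coincides with the direct image $p_!$ of the projection $p$ of $X$.
   Context: A locale is a frame; a homomorphism of locales preserves arbitrary joins and finite meets; a map of locales $f:X\to Y$ is a homomorphism $f^*:Y\to X$. A $B$-module is a complete lattice $X$ with an action $B\times X\to X$, $(b,x)\mapsto bx$, preserving arbitrary joins in each variable and satisfying $1x=x$ and $(b\wedge c)x=b(cx)$. A homomorphism of $B$-modules preserves arbitrary joins and the action. $B$ is a module over itself via $\wedge$. A map $\varsigma:X\to B$ is equivariant if $\varsigma(bx)=b\wedge\varsigma(x)$ for all $b\in B$, $x\in X$. A $B$-locale is a locale $X$ equipped with a $B$-module structure such that $bx=b1\wedge x$ for all $b\in B$, $x\in X$. Its projection is the map of locales $p:X\to B$ defined by $p^*(b)=b1$. A $B$-locale $X$ is open if $p^*:B\to X$ has a left adjoint $p_!:X\to B$ (the direct image of $p$) which is a homomorphism of $B$-modules. *)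

theory Defs
  imports Main
begin

text \<open>
  Locales are frames. The library class \<open>complete_distrib_lattice\<close> is too strong (it demands
  complete distributivity), so frames get a class of their own.
\<close>

class frame = complete_lattice +
  assumes inf_Sup_frame: "inf a (Sup S) = (SUP s\<in>S. inf a s)"

definition frame_hom :: "('a::frame \<Rightarrow> 'b::frame) \<Rightarrow> bool" where
  "frame_hom h \<longleftrightarrow>
     (\<forall>S. h (Sup S) = (SUP s\<in>S. h s)) \<and> h top = top \<and> (\<forall>a b. h (inf a b) = inf (h a) (h b))"

locale B_module =
  fixes act :: "'b::frame \<Rightarrow> 'x::complete_lattice \<Rightarrow> 'x"
  assumes act_Sup_left: "act (Sup S) x = (SUP b\<in>S. act b x)"
    and act_Sup_right: "act b (Sup T) = (SUP x\<in>T. act b x)"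
    and act_top: "act top x = x"
    and act_inf: "act (inf b c) x = act b (act c x)"

definition B_module_hom ::
  "('b::frame \<Rightarrow> 'x::complete_lattice \<Rightarrow> 'x) \<Rightarrow> ('b \<Rightarrow> 'y::complete_lattice \<Rightarrow> 'y) \<Rightarrow> ('x \<Rightarrow> 'y) \<Rightarrow> bool"
  where
  "B_module_hom act act' h \<longleftrightarrow>
     B_module act \<and> B_module act' \<and>
     (\<forall>S. h (Sup S) = (SUP x\<in>S. h x)) \<and> (\<forall>b x. h (act b x) = act' b (h x))"

locale B_locale = B_module act for act :: "'b::frame \<Rightarrow> 'x::frame \<Rightarrow> 'x" +
  assumes act_eq_inf: "act b x = inf (act b top) x"

definition equivariant :: "('b::frame \<Rightarrow> 'x::complete_lattice \<Rightarrow> 'x) \<Rightarrow> ('x \<Rightarrow> 'b) \<Rightarrow> bool" where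
  "equivariant act s \<longleftrightarrow> (\<forall>b x. s (act b x) = inf b (s x))"

text \<open>
  A map of locales \<open>p : X \<rightarrow> B\<close> is represented by its frame homomorphism \<open>p\<^sup>* : B \<rightarrow> X\<close>;
  \<open>projection_inv act\<close> is \<open>p\<^sup>*\<close> for the projection \<open>p\<close> of a \<open>B\<close>-locale.
\<close>

definition projection_inv :: "('b::frame \<Rightarrow> 'x::frame \<Rightarrow> 'x) \<Rightarrow> 'b \<Rightarrow> 'x" where
  "projection_inv act b = act b top"

definition left_adjoint :: "('x::order \<Rightarrow> 'b::order) \<Rightarrow> ('b \<Rightarrow> 'x) \<Rightarrow> bool" where
  "left_adjoint f g \<longleftrightarrow> (\<forall>x b. f x \<le> b \<longleftrightarrow> x \<le> g b)"

text \<open>\<open>is_direct_image act q\<close> says that \<open>q\<close> is \<open>p\<^sub>!\<close>; there need not be such a \<open>q\<close>.\<close>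

definition is_direct_image :: "('b::frame \<Rightarrow> 'x::frame \<Rightarrow> 'x) \<Rightarrow> ('x \<Rightarrow> 'b) \<Rightarrow> bool" where
  "is_direct_image act q \<longleftrightarrow> left_adjoint q (projection_inv act)"

definition open_B_locale :: "('b::frame \<Rightarrow> 'x::frame \<Rightarrow> 'x) \<Rightarrow> bool" where
  "open_B_locale act \<longleftrightarrow> (\<exists>q. is_direct_image act q \<and> B_module_hom act inf q)"

text \<open>
  The last three clauses are equivalent to one another for monotone equivariant maps, so any one
  of them would suffice; all are listed because their equivalence is left to be proved.
\<close>

definition support_map :: "('b::frame \<Rightarrow> 'x::frame \<Rightarrow> 'x) \<Rightarrow> ('x \<Rightarrow> 'b) \<Rightarrow> bool" where
  "support_map act s \<longleftrightarrow>
     mono s \<and> equivariant act s \<and>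
     (\<forall>x. act (s x) top \<ge> x) \<and>
     (\<forall>x. act (s x) x \<ge> x) \<and>
     (\<forall>x. act (s x) x = x)"

lemma B_module_inf: "B_module (inf :: 'b::frame \<Rightarrow> 'b \<Rightarrow> 'b)"
proof
  fix S :: "'b set" and x :: 'b
  have "inf (Sup S) x = inf x (Sup S)" by (rule inf_commute)
  then show "inf (Sup S) x = (SUP b\<in>S. inf b x)" by (simp add: inf_Sup_frame inf_commute)
qed (simp_all add: inf_Sup_frame inf_assoc)

lemma projection_inv_frame_hom:
  assumes "B_locale act"
  shows "frame_hom (projection_inv act)"
proof -
  interpret B_locale act by fact
  show ?thesis
    unfolding frame_hom_def projection_inv_def
    using act_Sup_left act_top act_inf act_eq_inf by metis
qed

lemma is_direct_image_unique:
  assumes "is_direct_image act q" "is_direct_image act r"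
  shows "q = r"
  using assms unfolding is_direct_image_def left_adjoint_def
  by (intro ext antisym) auto

end

theory Submission
  imports Defs
begin

text \<open>Condition (a) is the unit of an adjunction between \<open>s\<close> and the inverse
  image of the projection, and equivariance supplies the counit, since s(b1) = b \<and> s(1) \<le>
  b. So support maps are exactly the equivariant left adjoints
  (\<open>support_map_direct_image\<close>, \<open>direct_image_support_map\<close>). Uniqueness and
  preservation of joins are then general facts about left adjoints.\<close>

lemma left_adjoint_mono: "left_adjoint f g \<Longrightarrow> mono f"
  unfolding left_adjoint_def by (meson monoI order_refl order_trans)

text \<open>Both sides have the same upper bounds: by adjunction, each lies below \<open>b\<close>
  iff every element of \<open>S\<close> lies below \<open>g b\<close>.\<close>

lemma left_adjoint_Sup:
  fixes f :: "'x::complete_lattice \<Rightarrow> 'b::complete_lattice"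
  assumes "left_adjoint f g"
  shows "f (Sup S) = (SUP x\<in>S. f x)"
proof -
  have "f (Sup S) \<le> b \<longleftrightarrow> (SUP x\<in>S. f x) \<le> b" for b
    using assms by (simp add: left_adjoint_def Sup_le_iff SUP_le_iff)
  then show ?thesis by (meson order.antisym order_refl)
qed

context B_locale
begin

lemma act_le: "act b x \<le> x"
  by (metis act_eq_inf inf_le2)

lemma act_top_mono: "b \<le> c \<Longrightarrow> act b top \<le> act c top"
  by (metis act_eq_inf act_inf inf.absorb2 inf_le1)

text \<open>Because bx = b1 \<and> x. With \<open>b\<close> = s(x) this links conditions (a) and
  (b); \<open>le_act_iff\<close> links (b) and (c).\<close>

lemma le_act_top_iff: "x \<le> act b top \<longleftrightarrow> x \<le> act b x"
  by (metis act_eq_inf le_inf_iff order_refl)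

lemma le_act_iff: "x \<le> act b x \<longleftrightarrow> act b x = x"
  using act_le[of b x] by (auto intro: order.antisym)

lemma support_map_iff:
  "support_map act s \<longleftrightarrow> mono s \<and> equivariant act s \<and> (\<forall>x. x \<le> act (s x) top)"
  unfolding support_map_def by (simp add: le_act_top_iff le_act_iff)

lemma support_map_direct_image:
  assumes "support_map act s"
  shows "is_direct_image act s"
  unfolding is_direct_image_def left_adjoint_def projection_inv_def
proof (intro allI iffI)
  fix x b
  assume "s x \<le> b"
  then show "x \<le> act b top"
    using assms act_top_mono unfolding support_map_iff by (meson order_trans)
next
  fix x b
  assume "x \<le> act b top"
  \<comment> \<open>The counit in use: monotonicity moves the question to b1, where equivariance
    bounds the value by \<open>b\<close>.\<close>
  then have "s x \<le> s (act b top)"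
    using assms by (simp add: support_map_def monoD)
  also have "\<dots> = inf b (s top)"
    using assms by (simp add: support_map_def equivariant_def)
  finally show "s x \<le> b" by simp
qed

lemma support_map_module_hom:
  assumes "support_map act s"
  shows "B_module_hom act inf s"
  using assms left_adjoint_Sup[OF support_map_direct_image[OF assms, unfolded is_direct_image_def]]
    B_module_axioms B_module_inf
  unfolding B_module_hom_def support_map_def equivariant_def by blast

text \<open>Equivariance is part of being a module homomorphism into \<open>B\<close> acting on
  itself by meets; (a) is the adjunction applied to q(x) \<le> q(x).\<close>

lemma direct_image_support_map:
  assumes "is_direct_image act q" "B_module_hom act inf q"
  shows "support_map act q"
  using assms left_adjoint_mono[of q "projection_inv act"]
  unfolding support_map_iff is_direct_image_def left_adjoint_def projection_inv_def
    B_module_hom_def equivariant_def by blast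

lemma open_iff_support_map: "open_B_locale act \<longleftrightarrow> (\<exists>s. support_map act s)"
  unfolding open_B_locale_def
  using support_map_direct_image support_map_module_hom direct_image_support_map by blast

end

theorem theorem2p5:
  fixes act :: "'b::frame \<Rightarrow> 'x::frame \<Rightarrow> 'x"
  assumes "B_locale act"
  shows "(open_B_locale act \<longleftrightarrow> (\<exists>s. support_map act s))
    \<and> (\<forall>s. mono s \<and> equivariant act s \<longrightarrow>
         (\<forall>x. (act (s x) top \<ge> x \<longleftrightarrow> act (s x) x \<ge> x) \<and>
              (act (s x) x \<ge> x \<longleftrightarrow> act (s x) x = x)))
    \<and> (\<forall>s s'. support_map act s \<and> support_map act s' \<longrightarrow> s = s')
    \<and> (\<forall>s. support_map act s \<longrightarrow> B_module_hom act inf s \<and> is_direct_image act s)"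
proof -
  interpret B_locale act by fact
  show ?thesis
    using open_iff_support_map le_act_top_iff le_act_iff is_direct_image_unique
      support_map_direct_image support_map_module_hom
    by blast
qed

end
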